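(* The language $\mathbf{USSR}$ belongs to the complexity class $\mathbf{P}/\mathbf{poly}$.
   Context: $\mathbf{USSR}$ (unary sum of square roots) is the following decision problem. An instance consists of a positive integer $k$, positive integers $a_1,\dots,a_k$ with $1 \le a_i \le k$ for all $i$, and signs $\delta_1,\dots,\delta_k \in \{-1,1\}$; the numbers are given in unary, so an instance has size polynomial in $k$. The instance is a yes-instance if and only if $\sum_{i=1}^k \delta_i \sqrt{a_i} > 0$. $\mathbf{P}/\mathbf{poly}$ is the class of languages decidable by a polynomial-time Turing machine that, on inputs of length $n$, is also given an advice string depending only on $n$ and of length polynomial in $n$. *)

theory Defs
  imports Complex_Main "HOL-Computational_Algebra.Polynomial"
begin

section \<open>Deterministic multi-tape Turing machines\<close>

text \<open>
  States are the numbers below \<open>num_states\<close>, tape symbols the numbers below \<open>num_symbols\<close>.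
  Symbol 0 is the blank; symbols 1 and 2 represent the input bits 0 and 1.  Tapes are infinite
  in both directions.
\<close>

datatype move = MoveLeft | Stay | MoveRight

record tm =
  num_tapes :: nat
  num_states :: nat
  num_symbols :: nat
  start_state :: nat
  accept_state :: nat
  reject_state :: nat
  trans :: "nat \<Rightarrow> nat list \<Rightarrow> nat \<times> (nat \<times> move) list"

definition wf_tm :: "tm \<Rightarrow> bool" where
  "wf_tm M \<longleftrightarrow>
     num_tapes M \<ge> 2 \<and> num_symbols M \<ge> 3 \<and>
     start_state M < num_states M \<and>
     accept_state M < num_states M \<and>
     reject_state M < num_states M \<and>
     accept_state M \<noteq> reject_state M \<and>
     (\<forall>q ss q' acts.
        q < num_states M \<and> length ss = num_tapes M \<and> (\<forall>s\<in>set ss. s < num_symbols M) \<and>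
        trans M q ss = (q', acts) \<longrightarrow>
          q' < num_states M \<and> length acts = num_tapes M \<and>
          (\<forall>(s, m)\<in>set acts. s < num_symbols M))"

text \<open>A tape is its content together with the head position.\<close>

type_synonym tape = "(int \<Rightarrow> nat) \<times> int"
type_synonym tm_config = "nat \<times> tape list"

fun read_tape :: "tape \<Rightarrow> nat" where
  "read_tape (f, h) = f h"

fun move_head :: "move \<Rightarrow> int \<Rightarrow> int" where
  "move_head MoveLeft h = h - 1"
| "move_head Stay h = h"
| "move_head MoveRight h = h + 1"

fun act_tape :: "nat \<times> move \<Rightarrow> tape \<Rightarrow> tape" where
  "act_tape (s, m) (f, h) = (f(h := s), move_head m h)"

fun tm_step :: "tm \<Rightarrow> tm_config \<Rightarrow> tm_config" where
  "tm_step M (q, ts) =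
     (if q = accept_state M \<or> q = reject_state M then (q, ts)
      else let (q', acts) = trans M q (map read_tape ts) in (q', map2 act_tape acts ts))"

definition bits_tape :: "bool list \<Rightarrow> tape" where
  "bits_tape x =
     (\<lambda>i. if 0 \<le> i \<and> i < int (length x) then (if x ! nat i then 2 else 1) else 0, 0)"

definition blank_tape :: tape where
  "blank_tape = (\<lambda>_. 0, 0)"

text \<open>The input is on the first tape, the advice string on the second.\<close>

definition tm_init :: "tm \<Rightarrow> bool list \<Rightarrow> bool list \<Rightarrow> tm_config" where
  "tm_init M x y =
     (start_state M, [bits_tape x, bits_tape y] @ replicate (num_tapes M - 2) blank_tape)"

definition tm_accepts_within :: "tm \<Rightarrow> bool list \<Rightarrow> bool list \<Rightarrow> nat \<Rightarrow> bool" where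
  "tm_accepts_within M x y T \<longleftrightarrow>
     (\<exists>t\<le>T. fst ((tm_step M ^^ t) (tm_init M x y)) = accept_state M)"

definition tm_rejects_within :: "tm \<Rightarrow> bool list \<Rightarrow> bool list \<Rightarrow> nat \<Rightarrow> bool" where
  "tm_rejects_within M x y T \<longleftrightarrow>
     (\<exists>t\<le>T. fst ((tm_step M ^^ t) (tm_init M x y)) = reject_state M)"


section \<open>The class P/poly\<close>

definition P_poly :: "bool list set set" where
  "P_poly =
     {L. \<exists>(M :: tm) (p :: nat poly) (q :: nat poly) (adv :: nat \<Rightarrow> bool list).
           wf_tm M \<and>
           (\<forall>n. length (adv n) \<le> poly q n) \<and>
           (\<forall>x. if x \<in> L
                then tm_accepts_within M x (adv (length x)) (poly p (length x))
                else tm_rejects_within M x (adv (length x)) (poly p (length x)))}"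


section \<open>Unary sum of square roots\<close>

definition ussr_instance :: "nat \<Rightarrow> (nat \<Rightarrow> nat) \<Rightarrow> (nat \<Rightarrow> int) \<Rightarrow> bool" where
  "ussr_instance k a \<delta> \<longleftrightarrow>
     k \<ge> 1 \<and> (\<forall>i\<in>{1..k}. 1 \<le> a i \<and> a i \<le> k \<and> \<delta> i \<in> {-1, 1})"

text \<open>
  The word \<open>1\<^sup>k 0 s\<^sub>1 1\<^bsup>a\<^sub>1\<^esup> 0 \<dots> s\<^sub>k 1\<^bsup>a\<^sub>k\<^esup> 0\<close>, where the bit \<open>s\<^sub>i\<close> is 1 iff the \<open>i\<close>-th sign is positive.
\<close>

definition ussr_encode :: "nat \<Rightarrow> (nat \<Rightarrow> nat) \<Rightarrow> (nat \<Rightarrow> int) \<Rightarrow> bool list" where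
  "ussr_encode k a \<delta> =
     replicate k True @ [False] @
     concat (map (\<lambda>i. [\<delta> i = 1] @ replicate (a i) True @ [False]) [1..<Suc k])"

definition USSR :: "bool list set" where
  "USSR = {ussr_encode k a \<delta> | k a \<delta>.
     ussr_instance k a \<delta> \<and> (\<Sum>i = 1..k. real_of_int (\<delta> i) * sqrt (real (a i))) > 0}"

lemma unary_block_inject:
  "replicate m True @ False # xs = replicate n True @ False # ys \<longleftrightarrow> m = n \<and> xs = ys"
proof (induction m arbitrary: n)
  case 0
  then show ?case by (cases n) auto
next
  case (Suc m)
  then show ?case by (cases n) auto
qed

lemma ussr_blocks_inject:
  assumes "concat (map (\<lambda>i. [\<delta> i = 1] @ replicate (a i) True @ [False]) is) =
           concat (map (\<lambda>i. [\<delta>' i = 1] @ replicate (a' i) True @ [False]) is)"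
    and "i \<in> set is"
  shows "a i = a' i \<and> (\<delta> i = (1 :: int) \<longleftrightarrow> \<delta>' i = (1 :: int))"
  using assms by (induction "is") (auto simp: unary_block_inject)

lemma ussr_encode_inject:
  assumes "ussr_instance k a \<delta>" "ussr_instance k' a' \<delta>'"
    and "ussr_encode k a \<delta> = ussr_encode k' a' \<delta>'"
  shows "k = k' \<and> (\<forall>i\<in>{1..k}. a i = a' i \<and> \<delta> i = \<delta>' i)"
proof -
  have k: "k = k'"
    and eq: "concat (map (\<lambda>i. [\<delta> i = 1] @ replicate (a i) True @ [False]) [1..<Suc k]) =
             concat (map (\<lambda>i. [\<delta>' i = 1] @ replicate (a' i) True @ [False]) [1..<Suc k])"
    using assms(3) unfolding ussr_encode_def by (auto simp: unary_block_inject simp del: upt_Suc)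
  show ?thesis
  proof (intro conjI ballI k)
    fix i assume i: "i \<in> {1..k}"
    then have "i \<in> set [1..<Suc k]" by auto
    from ussr_blocks_inject[OF eq this]
    have *: "a i = a' i" "\<delta> i = 1 \<longleftrightarrow> \<delta>' i = 1" by auto
    show "a i = a' i" by (rule *)
    show "\<delta> i = \<delta>' i"
      using assms(1,2) i k *(2) unfolding ussr_instance_def by fastforce
  qed
qed

lemma ussr_encode_in_USSR_iff:
  assumes "ussr_instance k a \<delta>"
  shows "ussr_encode k a \<delta> \<in> USSR \<longleftrightarrow>
           (\<Sum>i = 1..k. real_of_int (\<delta> i) * sqrt (real (a i))) > 0"
proof
  assume "ussr_encode k a \<delta> \<in> USSR"
  then obtain k' a' \<delta>' where inst: "ussr_instance k' a' \<delta>'"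
    and eq: "ussr_encode k a \<delta> = ussr_encode k' a' \<delta>'"
    and pos: "(\<Sum>i = 1..k'. real_of_int (\<delta>' i) * sqrt (real (a' i))) > 0"
    unfolding USSR_def by auto
  have inj: "k = k'" "\<And>i. i \<in> {1..k} \<Longrightarrow> a i = a' i \<and> \<delta> i = \<delta>' i"
    using ussr_encode_inject[OF assms inst eq] by auto
  have "(\<Sum>i = 1..k. real_of_int (\<delta> i) * sqrt (real (a i))) =
        (\<Sum>i = 1..k'. real_of_int (\<delta>' i) * sqrt (real (a' i)))"
    using inj by (intro sum.cong) auto
  with pos show "(\<Sum>i = 1..k. real_of_int (\<delta> i) * sqrt (real (a i))) > 0" by simp
next
  assume "(\<Sum>i = 1..k. real_of_int (\<delta> i) * sqrt (real (a i))) > 0"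
  with assms show "ussr_encode k a \<delta> \<in> USSR" unfolding USSR_def by blast
qed

end

theory Submission
  imports Defs "HOL-Analysis.Kronecker_Approximation_Theorem"
begin

text \<open>
  Since \<open>\<surd>a\<close> is the sum of the increments \<open>\<surd>(j + 1) - \<surd>j\<close> over \<open>j < a\<close>, an input of length \<open>n\<close> asks
  for the sign of an integer combination of the increments with \<open>j < n\<close>, where the coefficients have
  \<open>1\<close>-norm at most \<open>n\<close>.  By the rounding technique of Frank and Tardos (iterated simultaneous
  Diophantine approximation) there are integers \<open>p\<^sub>j\<close> with polynomially many bits that yield the
  same sign for all these combinations at once.  The advice lists \<open>p\<^sub>0, p\<^sub>1, \<dots>\<close> in binary, so that a
  machine reading \<open>a\<^sub>i\<close> in unary adds or subtracts one advice word per symbol and never has to look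
  up an entry.
\<close>

section \<open>Integer weights with prescribed signs of small combinations\<close>

definition sign_equivalent :: "'i set \<Rightarrow> nat \<Rightarrow> ('i \<Rightarrow> real) \<Rightarrow> ('i \<Rightarrow> int) \<Rightarrow> bool" where
  "sign_equivalent I N w p \<longleftrightarrow>
     (\<forall>c :: 'i \<Rightarrow> int. (\<Sum>i\<in>I. \<bar>c i\<bar>) \<le> int N \<longrightarrow>
        sgn (\<Sum>i\<in>I. of_int (c i) * w i) = of_int (sgn (\<Sum>i\<in>I. c i * p i)))"

lemma abs_sum_mult_le:
  fixes c x :: "'i \<Rightarrow> 'a::linordered_idom"
  assumes "\<And>i. i \<in> I \<Longrightarrow> \<bar>x i\<bar> \<le> B"
  shows "\<bar>\<Sum>i\<in>I. c i * x i\<bar> \<le> (\<Sum>i\<in>I. \<bar>c i\<bar>) * B"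
proof -
  have "\<bar>\<Sum>i\<in>I. c i * x i\<bar> \<le> (\<Sum>i\<in>I. \<bar>c i * x i\<bar>)"
    by (rule sum_abs)
  also have "\<dots> \<le> (\<Sum>i\<in>I. \<bar>c i\<bar> * B)"
    using assms by (intro sum_mono) (simp add: abs_mult mult_left_mono)
  finally show ?thesis
    by (simp add: sum_distrib_right)
qed

lemma sgn_add_dominant:
  fixes a b :: "'a::linordered_idom"
  assumes "\<bar>b\<bar> < \<bar>a\<bar>"
  shows "sgn (a + b) = sgn a"
  using assms by (auto simp: sgn_if abs_if split: if_splits)

lemma sgn_lexicographic:
  fixes m a b :: int and r :: real
  assumes "\<bar>r\<bar> < 1" and "\<bar>b\<bar> < m" and "sgn r = of_int (sgn b)"
  shows "sgn (of_int a + r) = of_int (sgn (m * a + b))"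
proof (cases "a = 0")
  case True
  then show ?thesis using assms(3) by simp
next
  case False
  then have "\<bar>real_of_int a\<bar> \<ge> 1" by linarith
  with assms(1) have sgn_a: "sgn (of_int a + r) = sgn (real_of_int a)"
    by (intro sgn_add_dominant) linarith
  have "m * 1 \<le> m * \<bar>a\<bar>" using False assms(2) by (intro mult_left_mono) auto
  then have "\<bar>b\<bar> < \<bar>m * a\<bar>" using assms(2) by (simp add: abs_mult)
  then have "sgn (m * a + b) = sgn (m * a)" by (rule sgn_add_dominant)
  also have "\<dots> = sgn a" using assms(2) by (simp add: sgn_mult)
  finally show ?thesis using sgn_a by (simp add: sgn_if)
qed

lemma Dirichlet_approx_simult_finite:
  fixes \<theta> :: "'i \<Rightarrow> real"
  assumes "finite I" and "K > 0"
  obtains q p where "0 < q" and "q \<le> int (K ^ card I)"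
    and "\<And>i. i \<in> I \<Longrightarrow> \<bar>of_int q * \<theta> i - of_int (p i)\<bar> < 1 / real K"
proof -
  obtain h where h: "bij_betw h I {..<card I}"
    using bij_betw_iff_card[of I "{..<card I}"] assms(1) by auto
  obtain q p where q: "0 < q" "q \<le> int (K ^ card I)" and
    p: "\<And>j. j < card I \<Longrightarrow>
          \<bar>of_int q * (\<theta> \<circ> inv_into I h) j - of_int (p j)\<bar> < 1 / real K"
    using Dirichlet_approx_simult[OF assms(2), of "card I" "\<theta> \<circ> inv_into I h"] by blast
  have "\<bar>of_int q * \<theta> i - of_int ((p \<circ> h) i)\<bar> < 1 / real K" if "i \<in> I" for i
    using p[of "h i"] bij_betw_apply[OF h that] bij_betw_inv_into_left[OF h that] by simp
  with q show thesis by (rule that[of q "p \<circ> h"])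
qed

lemma Dirichlet_approx_simult_bounded:
  fixes \<theta> :: "'i \<Rightarrow> real"
  assumes "finite I" and K: "K > 1" and \<theta>: "\<And>i. i \<in> I \<Longrightarrow> \<bar>\<theta> i\<bar> \<le> 1"
  obtains q p where "0 < q"
    and "\<And>i. i \<in> I \<Longrightarrow> \<bar>p i\<bar> \<le> int (K ^ card I)"
    and "\<And>i. i \<in> I \<Longrightarrow> \<bar>of_int q * \<theta> i - of_int (p i)\<bar> < 1 / real K"
    and "\<And>i. i \<in> I \<Longrightarrow> \<theta> i \<in> \<int> \<Longrightarrow> of_int q * \<theta> i = of_int (p i)"
proof -
  obtain q p where q: "0 < q" "q \<le> int (K ^ card I)" and
    p: "\<And>i. i \<in> I \<Longrightarrow> \<bar>of_int q * \<theta> i - of_int (p i)\<bar> < 1 / real K"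
    using Dirichlet_approx_simult_finite[of I K \<theta>] assms(1) K by auto
  have lt1: "\<bar>of_int q * \<theta> i - of_int (p i)\<bar> < 1" if "i \<in> I" for i
  proof -
    have "1 / real K < 1" using K by simp
    with p[OF that] show ?thesis by linarith
  qed
  have "\<bar>p i\<bar> \<le> int (K ^ card I)" if i: "i \<in> I" for i
  proof -
    have "\<bar>of_int q * \<theta> i\<bar> \<le> of_int q"
      using \<theta>[OF i] q by (simp add: abs_mult mult_left_le)
    then have "\<bar>real_of_int (p i)\<bar> < of_int q + 1"
      using lt1[OF i] unfolding abs_le_iff abs_less_iff by linarith
    then show ?thesis using q(2) by linarith
  qed
  moreover have "of_int q * \<theta> i = of_int (p i)" if "i \<in> I" "\<theta> i \<in> \<int>" for i
  proof -
    from that(2) obtain j where "\<theta> i = of_int j" by (elim Ints_cases)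
    then have j: "of_int q * \<theta> i = of_int (q * j)" by simp
    then have "p i = q * j" using lt1[OF that(1)] by linarith
    with j show ?thesis by simp
  qed
  ultimately show thesis using q(1) p that by blast
qed

text \<open>
  After scaling to maximum norm \<open>1\<close>, an entry of modulus \<open>1\<close> is approximated exactly, so the
  remainder has fewer nonzero entries than \<open>w\<close>.
\<close>

lemma integer_approx_shrinks_support:
  fixes w :: "'i \<Rightarrow> real"
  assumes I: "finite I" and K: "K > 1" and "\<exists>i\<in>I. w i \<noteq> 0"
  obtains t :: real and p :: "'i \<Rightarrow> int"
  where "t > 0"
    and "\<And>i. i \<in> I \<Longrightarrow> \<bar>p i\<bar> \<le> int (K ^ card I)"
    and "\<And>i. i \<in> I \<Longrightarrow> \<bar>t * w i - of_int (p i)\<bar> < 1 / real K"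
    and "{i\<in>I. t * w i - of_int (p i) \<noteq> 0} \<subset> {i\<in>I. w i \<noteq> 0}"
proof -
  define s where "s = Max ((\<lambda>i. \<bar>w i\<bar>) ` I)"
  have "s \<in> (\<lambda>i. \<bar>w i\<bar>) ` I"
    unfolding s_def using I assms(3) by (intro Max_in) auto
  then obtain z where z: "z \<in> I" "\<bar>w z\<bar> = s" by auto
  have w_le: "\<bar>w i\<bar> \<le> s" if "i \<in> I" for i
    unfolding s_def using I that by (intro Max_ge) auto
  have s: "s > 0" using assms(3) w_le by (metis abs_le_zero_iff linorder_not_le order.trans)
  have "\<bar>w i / s\<bar> \<le> 1" if "i \<in> I" for i using w_le[OF that] s by simp
  then obtain q p where q: "0 < q"
    and p_le: "\<And>i. i \<in> I \<Longrightarrow> \<bar>p i\<bar> \<le> int (K ^ card I)"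
    and p: "\<And>i. i \<in> I \<Longrightarrow> \<bar>of_int q * (w i / s) - of_int (p i)\<bar> < 1 / real K"
    and exact: "\<And>i. i \<in> I \<Longrightarrow> w i / s \<in> \<int> \<Longrightarrow> of_int q * (w i / s) = of_int (p i)"
    using Dirichlet_approx_simult_bounded[OF I K, of "\<lambda>i. w i / s"] by blast
  show thesis
  proof (rule that[of "of_int q / s" p])
    show "of_int q / s > 0" using q s by simp
    have "w z / s = 1 \<or> w z / s = - 1" using z s by (auto simp: abs_if split: if_splits)
    then have "w z / s \<in> \<int>" by auto
    then have "of_int q / s * w z = of_int (p z)" using exact[OF z(1)] by simp
    moreover have "p i = 0" if "i \<in> I" "w i = 0" for i using exact[OF that(1)] that(2) by simp
    ultimately show "{i\<in>I. of_int q / s * w i - of_int (p i) \<noteq> 0} \<subset> {i\<in>I. w i \<noteq> 0}"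
      using z s by auto
  qed (use p p_le in auto)
qed

text \<open>
  If \<open>c \<cdot> p \<noteq> 0\<close>, it decides the sign of \<open>c \<cdot> w\<close>; otherwise the remainder does.  The weight
  \<open>N B\<close> makes the new integer vector perform this lexicographic comparison.
\<close>

lemma sign_equivalent_refine:
  fixes w :: "'i \<Rightarrow> real" and p p' :: "'i \<Rightarrow> int"
  assumes N: "N > 0" and t: "t > 0"
    and rem: "\<And>i. i \<in> I \<Longrightarrow> \<bar>t * w i - of_int (p i)\<bar> < 1 / real (Suc N)"
    and p': "sign_equivalent I N (\<lambda>i. t * w i - of_int (p i)) p'"
    and B: "B > 0" "\<And>i. i \<in> I \<Longrightarrow> \<bar>p' i\<bar> < B"
  shows "sign_equivalent I N w (\<lambda>i. int N * B * p i + p' i)"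
  unfolding sign_equivalent_def
proof (intro allI impI)
  fix c :: "'i \<Rightarrow> int"
  assume c: "(\<Sum>i\<in>I. \<bar>c i\<bar>) \<le> int N"
  define r where "r = (\<Sum>i\<in>I. of_int (c i) * (t * w i - of_int (p i)))"
  have "(\<Sum>i\<in>I. \<bar>real_of_int (c i)\<bar>) = real_of_int (\<Sum>i\<in>I. \<bar>c i\<bar>)" by simp
  also have "\<dots> \<le> real N" using c by linarith
  finally have norm: "(\<Sum>i\<in>I. \<bar>real_of_int (c i)\<bar>) \<le> real N" .
  have "\<bar>r\<bar> \<le> (\<Sum>i\<in>I. \<bar>real_of_int (c i)\<bar>) * (1 / real (Suc N))"
    unfolding r_def using rem by (intro abs_sum_mult_le less_imp_le)
  also have "\<dots> \<le> real N * (1 / real (Suc N))"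
    using norm by (intro mult_right_mono) auto
  also have "\<dots> < 1" by simp
  finally have r: "\<bar>r\<bar> < 1" .
  have "\<bar>\<Sum>i\<in>I. c i * p' i\<bar> \<le> (\<Sum>i\<in>I. \<bar>c i\<bar>) * (B - 1)"
    using B(2) by (intro abs_sum_mult_le) force
  also have "\<dots> \<le> int N * (B - 1)" using c B(1) by (intro mult_right_mono) auto
  also have "\<dots> < int N * B" using N by simp
  finally have b: "\<bar>\<Sum>i\<in>I. c i * p' i\<bar> < int N * B" .
  have "sgn (\<Sum>i\<in>I. of_int (c i) * w i) = sgn (t * (\<Sum>i\<in>I. of_int (c i) * w i))"
    using t by (simp add: sgn_mult)
  also have "t * (\<Sum>i\<in>I. of_int (c i) * w i) = of_int (\<Sum>i\<in>I. c i * p i) + r"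
    unfolding r_def by (simp add: sum_distrib_left sum.distrib[symmetric] algebra_simps)
  also have "sgn \<dots> = of_int (sgn (int N * B * (\<Sum>i\<in>I. c i * p i) + (\<Sum>i\<in>I. c i * p' i)))"
    using p' c unfolding sign_equivalent_def by (intro sgn_lexicographic r b) (simp add: r_def)
  also have "int N * B * (\<Sum>i\<in>I. c i * p i) + (\<Sum>i\<in>I. c i * p' i) =
      (\<Sum>i\<in>I. c i * (int N * B * p i + p' i))"
    by (simp add: sum_distrib_left sum.distrib algebra_simps)
  finally show "sgn (\<Sum>i\<in>I. of_int (c i) * w i) =
      of_int (sgn (\<Sum>i\<in>I. c i * (int N * B * p i + p' i)))" .
qed

lemma abs_lexicographic_less:
  fixes N B Q a b :: int
  assumes "N \<ge> 0" and "Q \<ge> 1" and "\<bar>a\<bar> \<le> Q" and "\<bar>b\<bar> < B"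
  shows "\<bar>N * B * a + b\<bar> < (N + 1) * Q * B"
proof -
  have "\<bar>N * B * a + b\<bar> \<le> N * B * \<bar>a\<bar> + \<bar>b\<bar>"
    using abs_triangle_ineq[of "N * B * a" b] assms by (simp add: abs_mult)
  also have "\<dots> < N * B * Q + B"
    using assms by (intro add_le_less_mono mult_left_mono) auto
  also have "\<dots> \<le> N * B * Q + B * Q"
    using assms mult_left_mono[of 1 Q B] by simp
  finally show ?thesis by (simp add: algebra_simps)
qed

lemma ex_sign_equivalent_card_support:
  fixes w :: "'i \<Rightarrow> real"
  assumes I: "finite I" and N: "N > 0" and "card {i\<in>I. w i \<noteq> 0} \<le> m"
  shows "\<exists>p. sign_equivalent I N w p \<and> (\<forall>i\<in>I. \<bar>p i\<bar> < int (Suc N) ^ (Suc (card I) * m))"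
  using assms(3)
proof (induction m arbitrary: w)
  case 0
  then have "\<forall>i\<in>I. w i = 0" using I by simp
  then show ?case by (intro exI[of _ "\<lambda>_. 0"]) (simp add: sign_equivalent_def)
next
  case (Suc m)
  let ?Q = "int (Suc N) ^ card I" and ?B = "int (Suc N) ^ (Suc (card I) * m)"
  show ?case
  proof (cases "\<exists>i\<in>I. w i \<noteq> 0")
    case False
    then show ?thesis by (intro exI[of _ "\<lambda>_. 0"]) (simp add: sign_equivalent_def)
  next
    case True
    from N have "Suc N > 1" by simp
    then obtain t :: real and p :: "'i \<Rightarrow> int" where
      t: "t > 0" and
      p: "\<And>i. i \<in> I \<Longrightarrow> \<bar>p i\<bar> \<le> int (Suc N ^ card I)" and
      rem: "\<And>i. i \<in> I \<Longrightarrow> \<bar>t * w i - of_int (p i)\<bar> < 1 / real (Suc N)" and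
      supp: "{i\<in>I. t * w i - of_int (p i) \<noteq> 0} \<subset> {i\<in>I. w i \<noteq> 0}"
      by (rule integer_approx_shrinks_support[OF I _ True]) blast
    have "card {i\<in>I. t * w i - of_int (p i) \<noteq> 0} \<le> m"
      using psubset_card_mono[OF _ supp] Suc.prems I by simp
    from Suc.IH[OF this] obtain p' where
      p': "sign_equivalent I N (\<lambda>i. t * w i - of_int (p i)) p'" "\<And>i. i \<in> I \<Longrightarrow> \<bar>p' i\<bar> < ?B"
      by blast
    have "\<bar>int N * ?B * p i + p' i\<bar> < (int N + 1) * ?Q * ?B" if "i \<in> I" for i
      using p[OF that] p'(2)[OF that] by (intro abs_lexicographic_less) simp_all
    moreover have "(int N + 1) * ?Q * ?B = int (Suc N) ^ (Suc (card I) * Suc m)"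
      by (simp add: power_add algebra_simps)
    moreover have "sign_equivalent I N w (\<lambda>i. int N * ?B * p i + p' i)"
      by (rule sign_equivalent_refine[OF N t rem p'(1) _ p'(2)]) simp_all
    ultimately show ?thesis by auto
  qed
qed

theorem ex_sign_equivalent:
  fixes w :: "'i \<Rightarrow> real"
  assumes "finite I" and "N > 0"
  obtains p where "sign_equivalent I N w p"
    and "\<And>i. i \<in> I \<Longrightarrow> \<bar>p i\<bar> < int (Suc N) ^ (Suc (card I) * card I)"
proof -
  have "card {i\<in>I. w i \<noteq> 0} \<le> card I" using assms(1) by (intro card_mono) auto
  from ex_sign_equivalent_card_support[OF assms this] show thesis using that by blast
qed

section \<open>Signed sums\<close>

definition signed_sum :: "('i \<Rightarrow> 'a::ab_group_add) \<Rightarrow> (bool \<times> 'i) list \<Rightarrow> 'a" where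
  "signed_sum f ts = (\<Sum>(s, j)\<leftarrow>ts. if s then f j else - f j)"

lemma signed_sum_simps [simp]:
  "signed_sum f [] = 0"
  "signed_sum f ((s, j) # ts) = (if s then f j else - f j) + signed_sum f ts"
  "signed_sum f (ts @ us) = signed_sum f ts + signed_sum f us"
  by (simp_all add: signed_sum_def)

definition signed_count :: "(bool \<times> 'i) list \<Rightarrow> 'i \<Rightarrow> int" where
  "signed_count ts i = signed_sum (\<lambda>j. of_bool (j = i)) ts"

lemma signed_sum_eq_sum_count:
  fixes f :: "'i \<Rightarrow> 'a::ring_1"
  assumes "finite I" and "snd ` set ts \<subseteq> I"
  shows "signed_sum f ts = (\<Sum>i\<in>I. of_int (signed_count ts i) * f i)"
  using assms(2)
proof (induction ts)
  case Nil
  then show ?case by (simp add: signed_count_def)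
next
  case (Cons t ts)
  obtain s j where t: "t = (s, j)" by fastforce
  have "(\<Sum>i\<in>I. of_int (signed_count (t # ts) i) * f i) =
      (\<Sum>i\<in>I. (if j = i then (if s then f i else - f i) else 0) + of_int (signed_count ts i) * f i)"
    by (intro sum.cong) (auto simp: t signed_count_def algebra_simps)
  also have "\<dots> = (if s then f j else - f j) + signed_sum f ts"
    using assms(1) Cons by (simp add: t sum.distrib)
  finally show ?case by (simp add: t)
qed

lemma sum_abs_signed_count_le:
  assumes "finite I"
  shows "(\<Sum>i\<in>I. \<bar>signed_count ts i\<bar>) \<le> int (length ts)"
proof (induction ts)
  case Nil
  then show ?case by (simp add: signed_count_def)
next
  case (Cons t ts)
  obtain s j where t: "t = (s, j)" by fastforce
  have "(\<Sum>i\<in>I. \<bar>signed_count (t # ts) i\<bar>) \<le>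
      (\<Sum>i\<in>I. (if j = i then 1 else 0) + \<bar>signed_count ts i\<bar>)"
    by (intro sum_mono) (auto simp: t signed_count_def)
  also have "\<dots> \<le> 1 + int (length ts)"
    using assms Cons by (simp add: sum.distrib)
  finally show ?case by simp
qed

lemma sgn_signed_sum_eq:
  assumes "finite I" and "sign_equivalent I N w p"
    and "snd ` set ts \<subseteq> I" and "length ts \<le> N"
  shows "sgn (signed_sum w ts) = of_int (sgn (signed_sum p ts))"
proof -
  have "(\<Sum>i\<in>I. \<bar>signed_count ts i\<bar>) \<le> int N"
    using sum_abs_signed_count_le[OF assms(1), of ts] assms(4) by linarith
  with assms(2) show ?thesis
    by (simp add: sign_equivalent_def signed_sum_eq_sum_count[OF assms(1,3)])
qed

lemma abs_signed_sum_le: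
  fixes f :: "'i \<Rightarrow> 'a::linordered_idom"
  assumes "\<And>j. j \<in> snd ` set ts \<Longrightarrow> \<bar>f j\<bar> \<le> B"
  shows "\<bar>signed_sum f ts\<bar> \<le> of_nat (length ts) * B"
  using assms
proof (induction ts)
  case (Cons t ts)
  obtain s j where t: "t = (s, j)" by fastforce
  have "\<bar>signed_sum f (t # ts)\<bar> \<le> \<bar>f j\<bar> + \<bar>signed_sum f ts\<bar>"
    using abs_triangle_ineq[of "if s then f j else - f j" "signed_sum f ts"]
    by (simp add: t split: if_splits)
  also have "\<dots> \<le> B + of_nat (length ts) * B"
    using Cons by (intro add_mono) (auto simp: t)
  finally show ?case by (simp add: algebra_simps)
qed simp

section \<open>Addition and subtraction of binary words\<close>

definition twos_complement :: "nat \<Rightarrow> int \<Rightarrow> bool list" where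
  "twos_complement L v = map (bit v) [0..<L]"

lemma length_twos_complement [simp]: "length (twos_complement L v) = L"
  by (simp add: twos_complement_def)

lemma twos_complement_0 [simp]: "twos_complement 0 v = []"
  by (simp add: twos_complement_def)

lemma twos_complement_Suc: "twos_complement (Suc L) v = odd v # twos_complement L (v div 2)"
  unfolding twos_complement_def
  by (subst upt_conv_Cons) (auto simp: bit_0 bit_Suc simp flip: map_Suc_upt simp del: upt_Suc)

lemma last_twos_complement: "L > 0 \<Longrightarrow> last (twos_complement L v) \<longleftrightarrow> bit v (L - 1)"
  by (simp add: twos_complement_def last_map)

lemma bit_top_iff_negative:
  fixes v :: int
  assumes "\<bar>v\<bar> < 2 ^ n"
  shows "bit v n \<longleftrightarrow> v < 0"
proof (cases "v < 0")
  case True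
  then have "v div 2 ^ n = - 1" using assms by (intro int_div_pos_eq[where r = "v + 2 ^ n"]) auto
  with True show ?thesis by (simp add: bit_iff_odd)
next
  case False
  with assms show ?thesis by (simp add: bit_iff_odd)
qed

definition sign_weight_width :: "nat \<Rightarrow> nat" where
  "sign_weight_width n = (n + 1) * ((n + 1) * n) + n + 1"

lemma ex_sign_weights:
  fixes w :: "nat \<Rightarrow> real" and n :: nat
  obtains p :: "nat \<Rightarrow> int"
  where "\<And>ts. length ts \<le> n \<Longrightarrow> snd ` set ts \<subseteq> {..<n} \<Longrightarrow>
    bit (- signed_sum p ts) (sign_weight_width n - 1) \<longleftrightarrow> signed_sum w ts > 0"
proof -
  let ?b = "(n + 1) * ((n + 1) * n)"
  obtain p where equiv: "sign_equivalent {..<n} (n + 1) w p"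
    and "\<And>j. j < n \<Longrightarrow> \<bar>p j\<bar> < int (Suc (n + 1)) ^ (Suc n * n)"
    using ex_sign_equivalent[of "{..<n}" "n + 1" w] by auto
  moreover have "int (Suc (n + 1)) ^ (Suc n * n) \<le> 2 ^ ?b"
  proof -
    have "int (Suc (n + 1)) \<le> 2 ^ (n + 1)"
      using less_exp[of "n + 1"] by (metis Suc_leI of_nat_le_iff of_nat_numeral of_nat_power)
    then have "int (Suc (n + 1)) ^ (Suc n * n) \<le> (2 ^ (n + 1)) ^ (Suc n * n)"
      by (intro power_mono) auto
    then show ?thesis by (simp only: power_mult Suc_eq_plus1)
  qed
  ultimately have bound: "\<bar>p j\<bar> \<le> 2 ^ ?b" if "j < n" for j using that by force
  show thesis
  proof (rule that[of p])
    fix ts :: "(bool \<times> nat) list"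
    assume ts: "length ts \<le> n" "snd ` set ts \<subseteq> {..<n}"
    have "\<bar>- signed_sum p ts\<bar> \<le> int (length ts) * 2 ^ ?b"
      unfolding abs_minus_cancel using ts(2) by (intro abs_signed_sum_le bound) auto
    also have "\<dots> \<le> int n * 2 ^ ?b" using ts(1) by (intro mult_right_mono) auto
    also have "\<dots> < 2 ^ n * 2 ^ ?b"
      by (intro mult_strict_right_mono of_nat_less_two_power) auto
    also have "\<dots> = 2 ^ (sign_weight_width n - 1)"
      by (simp add: sign_weight_width_def power_add)
    finally have "bit (- signed_sum p ts) (sign_weight_width n - 1) \<longleftrightarrow> signed_sum p ts > 0"
      by (simp add: bit_top_iff_negative)
    also have "\<dots> \<longleftrightarrow> signed_sum w ts > 0"
      using sgn_signed_sum_eq[OF _ equiv ts(2)] ts(1)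
      by (metis finite_lessThan of_int_0_less_iff sgn_greater trans_le_add1)
    finally show "bit (- signed_sum p ts) (sign_weight_width n - 1) \<longleftrightarrow> signed_sum w ts > 0" .
  qed
qed

definition sum_bit :: "bool \<Rightarrow> bool \<Rightarrow> bool \<Rightarrow> bool" where
  "sum_bit c d b \<longleftrightarrow> ((d \<noteq> b) \<noteq> c)"

text \<open>The flag \<open>s\<close> requests subtraction, where the borrow is the carry with \<open>d\<close> negated.\<close>

definition carry_bit :: "bool \<Rightarrow> bool \<Rightarrow> bool \<Rightarrow> bool \<Rightarrow> bool" where
  "carry_bit s c d b \<longleftrightarrow> (d \<noteq> s) \<and> b \<or> (d \<noteq> s) \<and> c \<or> b \<and> c"

text \<open>Missing digits of \<open>ds\<close> count as \<open>0\<close>: the accumulator is blank before the first addition.\<close>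

fun add_bits :: "bool \<Rightarrow> bool \<Rightarrow> bool list \<Rightarrow> bool list \<Rightarrow> bool list" where
  "add_bits s c ds [] = []"
| "add_bits s c ds (b # bs) =
     (let d = (ds \<noteq> [] \<and> hd ds)
      in sum_bit c d b # add_bits s (carry_bit s c d b) (tl ds) bs)"

lemma add_bits_twos_complement:
  "add_bits s c (twos_complement L v) (twos_complement L u) =
     twos_complement L (if s then v - (u + of_bool c) else v + (u + of_bool c))"
proof (induction L arbitrary: c v u)
  case 0
  show ?case by simp
next
  case (Suc L)
  let ?c = "carry_bit s c (odd v) (odd u)"
  let ?add = "\<lambda>v u c. if s then v - (u + of_bool c) else v + (u + of_bool c) :: int"
  have "odd (?add v u c) = sum_bit c (odd v) (odd u)"
    by (auto simp: sum_bit_def)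
  moreover have "?add v u c div 2 = ?add (v div 2) (u div 2) ?c"
    by (cases s; cases c; cases "even v"; cases "even u")
      (auto simp: carry_bit_def elim!: evenE oddE)
  ultimately show ?case by (simp add: twos_complement_Suc Suc.IH)
qed

lemma add_bits_Nil: "add_bits s c [] bs = add_bits s c (twos_complement (length bs) 0) bs"
  by (induction bs arbitrary: c) (simp_all add: twos_complement_Suc)

section \<open>Computations and tapes\<close>

definition reaches :: "tm \<Rightarrow> nat \<Rightarrow> tm_config \<Rightarrow> tm_config \<Rightarrow> bool" where
  "reaches M T cf cf' \<longleftrightarrow> (\<exists>t\<le>T. (tm_step M ^^ t) cf = cf')"

definition decides :: "tm \<Rightarrow> nat \<Rightarrow> tm_config \<Rightarrow> bool \<Rightarrow> bool" where
  "decides M T cf b \<longleftrightarrow>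
     (\<exists>t\<le>T. fst ((tm_step M ^^ t) cf) = (if b then accept_state M else reject_state M))"

lemma reaches_refl [simp]: "reaches M T cf cf"
  unfolding reaches_def by (intro exI[of _ 0]) simp

lemma reaches_step: "tm_step M cf = cf' \<Longrightarrow> reaches M 1 cf cf'"
  unfolding reaches_def by (intro exI[of _ 1]) simp

lemma reaches_trans:
  assumes "reaches M T cf cf'" and "reaches M T' cf' cf''"
  shows "reaches M (T + T') cf cf''"
proof -
  obtain t t' where "t \<le> T" "(tm_step M ^^ t) cf = cf'" "t' \<le> T'" "(tm_step M ^^ t') cf' = cf''"
    using assms unfolding reaches_def by blast
  then show ?thesis
    unfolding reaches_def by (intro exI[of _ "t' + t"]) (simp add: funpow_add)
qed

lemma reaches_mono: "reaches M T cf cf' \<Longrightarrow> T \<le> T' \<Longrightarrow> reaches M T' cf cf'"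
  unfolding reaches_def using order.trans by blast

lemma decides_mono: "decides M T cf b \<Longrightarrow> T \<le> T' \<Longrightarrow> decides M T' cf b"
  unfolding decides_def using order.trans by blast

lemma decides_iff_reaches:
  "decides M T cf b \<longleftrightarrow>
     (\<exists>cf'. reaches M T cf cf' \<and> fst cf' = (if b then accept_state M else reject_state M))"
  unfolding decides_def reaches_def by blast

lemma decides_step:
  "fst (tm_step M cf) = (if b then accept_state M else reject_state M) \<Longrightarrow> decides M 1 cf b"
  unfolding decides_iff_reaches using reaches_step by blast

lemma reaches_decides: "reaches M T cf cf' \<Longrightarrow> decides M T' cf' b \<Longrightarrow> decides M (T + T') cf b"
  unfolding decides_iff_reaches using reaches_trans by blast

lemma decides_tm_init_iff:
  "decides M T (tm_init M x y) b \<longleftrightarrow>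
     (if b then tm_accepts_within M x y T else tm_rejects_within M x y T)"
  by (simp add: decides_def tm_accepts_within_def tm_rejects_within_def)

definition bit_symbol :: "bool \<Rightarrow> nat" where
  "bit_symbol b = (if b then 2 else 1)"

lemma bit_symbol_simps [simp]:
  "bit_symbol b = 2 \<longleftrightarrow> b" "bit_symbol b = 1 \<longleftrightarrow> \<not> b" "bit_symbol b = Suc 0 \<longleftrightarrow> \<not> b"
  "bit_symbol b \<noteq> 0" "bit_symbol b < 3"
  by (simp_all add: bit_symbol_def)

definition tape_at :: "bool list \<Rightarrow> int \<Rightarrow> tape" where
  "tape_at xs h = (fst (bits_tape xs), h)"

abbreviation tape_split :: "bool list \<Rightarrow> bool list \<Rightarrow> tape" where
  "tape_split us vs \<equiv> tape_at (us @ vs) (int (length us))"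

abbreviation tape_end :: "bool list \<Rightarrow> tape" where
  "tape_end us \<equiv> tape_at us (int (length us))"

definition move_tape :: "move \<Rightarrow> tape \<Rightarrow> tape" where
  "move_tape m = apsnd (move_head m)"

lemma bits_tape_eq_tape_at: "bits_tape xs = tape_at xs 0"
  by (simp add: tape_at_def bits_tape_def)

lemma blank_tape_eq_tape_at: "blank_tape = tape_at [] 0"
  by (auto simp: tape_at_def blank_tape_def bits_tape_def)

lemma read_tape_at:
  "read_tape (tape_at xs h) = (if 0 \<le> h \<and> h < int (length xs) then bit_symbol (xs ! nat h) else 0)"
  by (simp add: tape_at_def bits_tape_def bit_symbol_def)

lemma read_tape_split [simp]:
  "read_tape (tape_split xs (b # ys)) = bit_symbol b"
  by (simp add: read_tape_at)

lemma read_tape_end [simp]: "read_tape (tape_end xs) = 0"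
  by (simp add: read_tape_at)

lemma move_tape_Stay [simp]: "move_tape Stay X = X"
  by (cases X) (simp add: move_tape_def)

lemma move_tape_at [simp]: "move_tape m (tape_at xs h) = tape_at xs (move_head m h)"
  by (simp add: move_tape_def tape_at_def)

lemma act_tape_read: "read_tape X = u \<Longrightarrow> act_tape (u, m) X = move_tape m X"
  by (cases X) (simp add: move_tape_def fun_upd_idem)

text \<open>For \<open>ys = []\<close> the written bit extends the word.\<close>

lemma act_tape_split:
  "act_tape (bit_symbol b, m) (tape_split xs ys) =
     tape_at (xs @ b # tl ys) (move_head m (int (length xs)))"
proof -
  have "((fst (bits_tape (xs @ ys)))(int (length xs) := bit_symbol b)) i =
      fst (bits_tape (xs @ b # tl ys)) i" for i
  proof (cases "0 \<le> i")
    case True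
    then obtain j where "i = int j" by (metis nonneg_int_cases)
    then show ?thesis
      by (cases ys) (auto simp: bits_tape_def bit_symbol_def nth_append nth_Cons' Suc_diff_le)
  qed (simp add: bits_tape_def)
  then show ?thesis by (auto simp: tape_at_def)
qed

section \<open>The Turing machine\<close>

text \<open>
  The five tapes carry the input, the advice, the accumulator and two copies of \<open>k\<close> in unary.  The
  first copy bounds the length of the current unary block, the second counts the blocks.  The
  accumulator holds \<open>- V mod 2\<^sup>L\<close>, least significant bit first, where \<open>V\<close> is the signed sum read so
  far and \<open>L\<close> the common length of the advice words; its top bit is set iff \<open>V > 0\<close>.

  The first argument of the parametrised states is the sign of the current block.  The second one
  records in \<open>Unary\<close> whether the block is already nonempty, in \<open>Digit\<close> and \<open>Bit\<close> the carry or
  borrow.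
\<close>

datatype ussr_state =
    Accept | Reject | Prefix | Block | Final
  | Rewind bool | Unary bool bool | AccRewind bool | Digit bool bool | Bit bool bool

fun encode_state :: "ussr_state \<Rightarrow> nat" where
  "encode_state Accept = 0"
| "encode_state Reject = 1"
| "encode_state Prefix = 2"
| "encode_state Block = 3"
| "encode_state Final = 4"
| "encode_state (Rewind s) = 5 + of_bool s"
| "encode_state (Unary s z) = 7 + 2 * of_bool s + of_bool z"
| "encode_state (AccRewind s) = 11 + of_bool s"
| "encode_state (Digit s r) = 13 + 2 * of_bool s + of_bool r"
| "encode_state (Bit s r) = 17 + 2 * of_bool s + of_bool r"

lemma encode_state_less: "encode_state s < 21"
  by (cases s) auto

lemma encode_state_eq_iff [simp]: "encode_state s = encode_state t \<longleftrightarrow> s = t"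
  by (cases s; cases t) (auto simp: of_bool_def)

lemma inv_encode_state [simp]: "inv encode_state (encode_state s) = s"
  by (simp add: inv_f_f inj_def)

fun ussr_move :: "ussr_state \<Rightarrow> nat \<Rightarrow> nat \<Rightarrow> nat \<Rightarrow> nat \<Rightarrow> nat \<Rightarrow> ussr_state \<times> move list" where
  "ussr_move Prefix x y a k c =
     (if x = 2 then (Prefix, [MoveRight, Stay, Stay, MoveRight, MoveRight])
      else if x = 1 then (Block, [MoveRight, Stay, Stay, Stay, MoveLeft])
      else (Reject, [Stay, Stay, Stay, Stay, Stay]))"
| "ussr_move Block x y a k c =
     (if x = 0 \<and> c = 0 then (Final, [Stay, Stay, MoveLeft, Stay, Stay])
      else if x = 0 \<or> c = 0 then (Reject, [Stay, Stay, Stay, Stay, Stay])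
      else (Rewind (x = 2), [MoveRight, MoveLeft, Stay, MoveLeft, MoveLeft]))"
| "ussr_move (Rewind s) x y a k c =
     (if y = 0 \<and> k = 0 then (Unary s False, [Stay, MoveRight, Stay, MoveRight, Stay])
      else (Rewind s, [Stay, if y = 0 then Stay else MoveLeft, Stay,
                       if k = 0 then Stay else MoveLeft, Stay]))"
| "ussr_move (Unary s z) x y a k c =
     (if x = 2 \<and> k \<noteq> 0 then (AccRewind s, [MoveRight, Stay, MoveLeft, MoveRight, Stay])
      else if x = 1 \<and> z then (Block, [MoveRight, Stay, Stay, Stay, Stay])
      else (Reject, [Stay, Stay, Stay, Stay, Stay]))"
| "ussr_move (AccRewind s) x y a k c =
     (if a = 0 then (Digit s False, [Stay, Stay, MoveRight, Stay, Stay])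
      else (AccRewind s, [Stay, Stay, MoveLeft, Stay, Stay]))"
| "ussr_move (Digit s r) x y a k c =
     (if y = 2 then Bit s r else Unary s True, [Stay, MoveRight, Stay, Stay, Stay])"
| "ussr_move (Bit s r) x y a k c =
     (Digit s (carry_bit s r (a = 2) (y = 2)), [Stay, MoveRight, MoveRight, Stay, Stay])"
| "ussr_move Final x y a k c =
     (if a = 2 then Accept else Reject, [Stay, Stay, Stay, Stay, Stay])"
| "ussr_move s x y a k c = (s, [Stay, Stay, Stay, Stay, Stay])"

fun ussr_write :: "ussr_state \<Rightarrow> nat \<Rightarrow> nat \<Rightarrow> nat \<Rightarrow> nat \<Rightarrow> nat \<Rightarrow> nat list" where
  "ussr_write Prefix x y a k c = (if x = 2 then [x, y, a, 1, 1] else [x, y, a, k, c])"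
| "ussr_write (Bit s r) x y a k c = [x, y, bit_symbol (sum_bit r (a = 2) (y = 2)), k, c]"
| "ussr_write s x y a k c = [x, y, a, k, c]"

definition ussr_tm :: tm where
  "ussr_tm =
     \<lparr>num_tapes = 5, num_states = 21, num_symbols = 3,
      start_state = encode_state Prefix,
      accept_state = encode_state Accept,
      reject_state = encode_state Reject,
      trans = (\<lambda>q ss.
        let s = inv encode_state q; x = ss ! 0; y = ss ! 1; a = ss ! 2; k = ss ! 3; c = ss ! 4;
            (s', ms) = ussr_move s x y a k c
        in (encode_state s', zip (ussr_write s x y a k c) ms))\<rparr>"

lemma ussr_tm_simps [simp]:
  "num_tapes ussr_tm = 5"
  "num_states ussr_tm = 21"
  "num_symbols ussr_tm = 3"
  "start_state ussr_tm = encode_state Prefix"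
  "accept_state ussr_tm = encode_state Accept"
  "reject_state ussr_tm = encode_state Reject"
  by (simp_all add: ussr_tm_def)

lemma length_ussr_move: "ussr_move s x y a k c = (s', ms) \<Longrightarrow> length ms = 5"
  by (cases s) (auto split: if_splits)

lemma length_ussr_write: "length (ussr_write s x y a k c) = 5"
  by (cases s) auto

lemma ussr_write_less_3:
  assumes "x < 3" "y < 3" "a < 3" "k < 3" "c < 3"
  shows "\<forall>u\<in>set (ussr_write s x y a k c). u < 3"
  using assms by (cases s) auto

lemma wf_ussr_tm: "wf_tm ussr_tm"
proof -
  have "q' < 21 \<and> length acts = 5 \<and> (\<forall>(u, m)\<in>set acts. u < 3)"
    if ss: "length ss = 5" "\<forall>s\<in>set ss. s < 3" and "trans ussr_tm q ss = (q', acts)"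
    for q ss q' acts
  proof -
    let ?s = "inv encode_state q"
    let ?us = "ussr_write ?s (ss ! 0) (ss ! 1) (ss ! 2) (ss ! 3) (ss ! 4)"
    obtain s' ms where "ussr_move ?s (ss ! 0) (ss ! 1) (ss ! 2) (ss ! 3) (ss ! 4) = (s', ms)"
      by fastforce
    moreover from this have "q' = encode_state s'" "acts = zip ?us ms"
      using that(3) by (simp_all add: ussr_tm_def)
    moreover have "\<forall>u\<in>set ?us. u < 3"
      using ss by (intro ussr_write_less_3) auto
    ultimately show ?thesis
      using length_ussr_move length_ussr_write encode_state_less by (auto dest: set_zip_leftD)
  qed
  then show ?thesis
    unfolding wf_tm_def by (simp add: encode_state_less) blast
qed

declare encode_state.simps [simp del] tm_step.simps [simp del]

abbreviation config :: "ussr_state \<Rightarrow> tape \<Rightarrow> tape \<Rightarrow> tape \<Rightarrow> tape \<Rightarrow> tape \<Rightarrow> tm_config" where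
  "config s X Y A K C \<equiv> (encode_state s, [X, Y, A, K, C])"

lemma tm_step_config:
  assumes "s \<noteq> Accept" "s \<noteq> Reject"
  shows "tm_step ussr_tm (config s X Y A K C) =
    (let x = read_tape X; y = read_tape Y; a = read_tape A; k = read_tape K; c = read_tape C;
         (s', ms) = ussr_move s x y a k c
     in (encode_state s', map2 act_tape (zip (ussr_write s x y a k c) ms) [X, Y, A, K, C]))"
  using assms by (simp add: tm_step.simps) (simp add: ussr_tm_def Let_def split: prod.split)

lemma tm_step_move:
  assumes "s \<noteq> Accept" "s \<noteq> Reject"
    and "ussr_write s (read_tape X) (read_tape Y) (read_tape A) (read_tape K) (read_tape C) =
      [read_tape X, read_tape Y, read_tape A, read_tape K, read_tape C]"
  shows "tm_step ussr_tm (config s X Y A K C) =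
    (case ussr_move s (read_tape X) (read_tape Y) (read_tape A) (read_tape K) (read_tape C) of
       (s', ms) \<Rightarrow> (encode_state s', map2 move_tape ms [X, Y, A, K, C]))"
proof -
  obtain s' ms where ms:
    "ussr_move s (read_tape X) (read_tape Y) (read_tape A) (read_tape K) (read_tape C) = (s', ms)"
    by fastforce
  then have "length ms = 5" by (rule length_ussr_move)
  then obtain m1 m2 m3 m4 m5 where "ms = [m1, m2, m3, m4, m5]"
    by (auto simp: numeral_eq_Suc length_Suc_conv)
  with ms show ?thesis
    unfolding tm_step_config[OF assms(1,2)] Let_def assms(3)
    by (simp add: act_tape_read)
qed

section \<open>Rewinding and addition\<close>

definition advice_block :: "bool list \<Rightarrow> bool list" where
  "advice_block bs = concat (map (\<lambda>b. [True, b]) bs) @ [False]"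

definition ussr_advice :: "nat \<Rightarrow> (nat \<Rightarrow> int) \<Rightarrow> nat \<Rightarrow> bool list" where
  "ussr_advice L p n = concat (map (\<lambda>j. advice_block (twos_complement L (p j))) [0..<n])"

lemma length_advice_block [simp]: "length (advice_block bs) = 2 * length bs + 1"
  unfolding advice_block_def by (induction bs) auto

lemma ussr_advice_Suc:
  "ussr_advice L p (Suc n) = ussr_advice L p n @ advice_block (twos_complement L (p n))"
  by (simp add: ussr_advice_def)

lemma length_ussr_advice [simp]: "length (ussr_advice L p n) = n * (2 * L + 1)"
  by (induction n) (simp_all add: ussr_advice_Suc, simp add: ussr_advice_def)

lemma ussr_advice_split:
  assumes "j < n"
  obtains ys where "ussr_advice L p n =
    ussr_advice L p j @ advice_block (twos_complement L (p j)) @ ys"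
proof -
  have "[0..<n] = [0..<j] @ j # [Suc j..<n]"
    using assms upt_add_eq_append[of 0 j "n - j"] by (simp add: upt_conv_Cons)
  then show thesis using that by (simp add: ussr_advice_def)
qed

text \<open>One head may reach the left end before the other; it then waits on the blank.\<close>

lemma reaches_Rewind:
  assumes "i \<le> m" "j \<le> m" "i \<le> length ys" "j \<le> length ks"
  shows "reaches ussr_tm (m + 1)
    (config (Rewind s) X (tape_at ys (int i - 1)) A (tape_at ks (int j - 1)) C)
    (config (Unary s False) X (tape_at ys 0) A (tape_at ks 0) C)"
  using assms
proof (induction m arbitrary: i j)
  case 0
  then have "reaches ussr_tm 1
      (config (Rewind s) X (tape_at ys (int i - 1)) A (tape_at ks (int j - 1)) C)
      (config (Unary s False) X (tape_at ys 0) A (tape_at ks 0) C)"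
    by (intro reaches_step) (simp add: tm_step_move read_tape_at)
  then show ?case by simp
next
  case (Suc m)
  let ?rewind = "\<lambda>i j. config (Rewind s) X (tape_at ys (int i - 1)) A (tape_at ks (int j - 1)) C"
  let ?unary = "config (Unary s False) X (tape_at ys 0) A (tape_at ks 0) C"
  show ?case
  proof (cases "i = 0 \<and> j = 0")
    case True
    then have "reaches ussr_tm 1 (?rewind i j) ?unary"
      by (intro reaches_step) (simp add: tm_step_move read_tape_at)
    then show ?thesis by (rule reaches_mono) simp
  next
    case False
    then have "tm_step ussr_tm (?rewind i j) = ?rewind (i - 1) (j - 1)"
      using Suc.prems by (cases i; cases j) (auto simp: tm_step_move read_tape_at)
    from reaches_trans[OF reaches_step[OF this] Suc.IH[of "i - 1" "j - 1"]] show ?thesis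
      using Suc.prems by simp
  qed
qed

lemma reaches_AccRewind:
  assumes "i \<le> length as"
  shows "reaches ussr_tm (i + 1) (config (AccRewind s) X Y (tape_at as (int i - 1)) K C)
    (config (Digit s False) X Y (tape_at as 0) K C)"
  using assms
proof (induction i)
  case 0
  have "reaches ussr_tm 1 (config (AccRewind s) X Y (tape_at as (- 1)) K C)
      (config (Digit s False) X Y (tape_at as 0) K C)"
    by (intro reaches_step) (simp add: tm_step_move read_tape_at)
  then show ?case by simp
next
  case (Suc i)
  then have "tm_step ussr_tm (config (AccRewind s) X Y (tape_at as (int (Suc i) - 1)) K C) =
      config (AccRewind s) X Y (tape_at as (int i - 1)) K C"
    by (simp add: tm_step_move read_tape_at)
  from reaches_trans[OF reaches_step[OF this] Suc.IH] show ?case using Suc.prems by simp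
qed

lemma reaches_add_digit:
  fixes b s r :: bool and ds :: "bool list"
  defines "d \<equiv> ds \<noteq> [] \<and> hd ds"
  shows "reaches ussr_tm 2
    (config (Digit s r) X (tape_split ys (True # b # zs)) (tape_split as ds) K C)
    (config (Digit s (carry_bit s r d b)) X
       (tape_split (ys @ [True, b]) zs) (tape_split (as @ [sum_bit r d b]) (tl ds)) K C)"
    (is "reaches _ _ ?start ?end")
proof -
  let ?Y = "tape_at (ys @ True # b # zs) (int (length ys) + 1)"
  let ?A = "tape_split as ds"
  have b: "read_tape ?Y = bit_symbol b"
    using read_tape_split[of "ys @ [True]" b zs] by (simp add: add.commute)
  have d: "read_tape ?A = 2 \<longleftrightarrow> d"
    by (cases ds) (simp_all add: d_def)
  have "tm_step ussr_tm ?start = config (Bit s r) X ?Y ?A K C"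
    by (simp add: tm_step_move)
  moreover have "tm_step ussr_tm (config (Bit s r) X ?Y ?A K C) = ?end"
    by (simp add: tm_step_config Let_def act_tape_split act_tape_read[OF b] act_tape_read[OF refl]
        b d add.commute[of 1])
  ultimately show ?thesis
    using reaches_trans[OF reaches_step reaches_step] by (metis one_add_one)
qed

lemma reaches_add_bits:
  assumes "length ds = length bs \<or> ds = []"
  shows "reaches ussr_tm (2 * length bs + 1)
    (config (Digit s r) X (tape_split ys (advice_block bs @ zs)) (tape_split as ds) K C)
    (config (Unary s True) X (tape_split (ys @ advice_block bs) zs)
       (tape_end (as @ add_bits s r ds bs)) K C)"
  using assms
proof (induction bs arbitrary: ys as ds r)
  case Nil
  then have "reaches ussr_tm 1
      (config (Digit s r) X (tape_split ys (advice_block [] @ zs)) (tape_split as ds) K C)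
      (config (Unary s True) X (tape_split (ys @ advice_block []) zs)
         (tape_end (as @ add_bits s r ds [])) K C)"
    by (intro reaches_step) (simp add: tm_step_move advice_block_def add.commute)
  then show ?case by simp
next
  case (Cons b bs)
  then have "length (tl ds) = length bs \<or> tl ds = []" by auto
  from reaches_trans[OF reaches_add_digit Cons.IH[OF this]] show ?case
    by (simp add: advice_block_def Let_def)
qed

section \<open>Scanning the input\<close>

text \<open>
  The signed increments that the machine adds on an input of \<open>c\<close> remaining blocks.  \<open>None\<close> is the
  start of a block, \<open>Some (s, j)\<close> the position after \<open>j\<close> ones of a block with sign \<open>s\<close>.
\<close>

context
  fixes k :: nat
begin

fun ussr_scan :: "(bool \<times> nat) option \<Rightarrow> nat \<Rightarrow> bool list \<Rightarrow> (bool \<times> nat) list option" where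
  "ussr_scan None 0 [] = Some []"
| "ussr_scan None (Suc c) [] = None"
| "ussr_scan None 0 (s # xs) = None"
| "ussr_scan None (Suc c) (s # xs) = ussr_scan (Some (s, 0)) c xs"
| "ussr_scan (Some (s, j)) c [] = None"
| "ussr_scan (Some (s, j)) c (True # xs) =
     (if j < k then map_option (Cons (s, j)) (ussr_scan (Some (s, Suc j)) c xs) else None)"
| "ussr_scan (Some (s, j)) c (False # xs) = (if 0 < j then ussr_scan None c xs else None)"

end

definition holds_negative :: "nat \<Rightarrow> bool list \<Rightarrow> int \<Rightarrow> bool" where
  "holds_negative L as V \<longleftrightarrow> as = twos_complement L (- V) \<or> as = [] \<and> V = 0"

lemma holds_negative_add_bits:
  assumes "holds_negative L as V"
  shows "holds_negative L (add_bits s False as (twos_complement L v)) (V + (if s then v else - v))"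
proof -
  have "add_bits s False as (twos_complement L v) =
      add_bits s False (twos_complement L (- V)) (twos_complement L v)"
    using assms by (auto simp: holds_negative_def add_bits_Nil)
  then show ?thesis by (simp add: holds_negative_def add_bits_twos_complement)
qed

lemma read_top_bit:
  assumes "holds_negative L as V" and "L > 0"
  shows "read_tape (tape_at as (int (length as) - 1)) = 2 \<longleftrightarrow> bit (- V) (L - 1)"
proof (cases "as = []")
  case True
  with assms have "V = 0" by (auto simp: holds_negative_def dest: arg_cong[of _ _ length])
  with True show ?thesis by (simp add: read_tape_at)
next
  case False
  then have "as = twos_complement L (- V)" using assms by (simp add: holds_negative_def)
  with False assms(2) last_twos_complement[OF assms(2), of "- V"] show ?thesis
    by (auto simp: read_tape_at last_conv_nth nat_diff_distrib)
qed

definition scan_accepts ::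
  "nat \<Rightarrow> (nat \<Rightarrow> int) \<Rightarrow> nat \<Rightarrow> (bool \<times> nat) option \<Rightarrow> nat \<Rightarrow> int \<Rightarrow> bool list \<Rightarrow> bool" where
  "scan_accepts L p k pos c V xs \<longleftrightarrow>
     (\<exists>ts\<in>set_option (ussr_scan k pos c xs). bit (- (V + signed_sum p ts)) (L - 1))"

lemma scan_accepts_simps:
  "scan_accepts L p k None 0 V [] \<longleftrightarrow> bit (- V) (L - 1)"
  "scan_accepts L p k None (Suc c) V [] \<longleftrightarrow> False"
  "scan_accepts L p k None 0 V (s # xs) \<longleftrightarrow> False"
  "scan_accepts L p k None (Suc c) V (s # xs) \<longleftrightarrow> scan_accepts L p k (Some (s, 0)) c V xs"
  "scan_accepts L p k (Some (s, j)) c V [] \<longleftrightarrow> False"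
  "scan_accepts L p k (Some (s, j)) c V (True # xs) \<longleftrightarrow>
     j < k \<and> scan_accepts L p k (Some (s, Suc j)) c (V + (if s then p j else - p j)) xs"
  "scan_accepts L p k (Some (s, j)) c V (False # xs) \<longleftrightarrow> 0 < j \<and> scan_accepts L p k None c V xs"
  by (simp_all add: scan_accepts_def option.set_map algebra_simps)

definition ussr_accepts :: "nat \<Rightarrow> (nat \<Rightarrow> int) \<Rightarrow> bool list \<Rightarrow> bool" where
  "ussr_accepts L p x \<longleftrightarrow>
     (\<exists>k xs. x = replicate k True @ False # xs \<and> scan_accepts L p k None k 0 xs)"

definition scan_step_time :: "nat \<Rightarrow> nat \<Rightarrow> nat" where
  "scan_step_time L n = n * (2 * L + 1) + n + 3 * L + 3"

context
  fixes L n k :: nat and p :: "nat \<Rightarrow> int"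
  assumes L: "L > 0" and k: "k \<le> n"
begin

abbreviation counter_tape :: "int \<Rightarrow> tape" where
  "counter_tape \<equiv> tape_at (replicate k False)"

abbreviation advice_tape :: "int \<Rightarrow> tape" where
  "advice_tape \<equiv> tape_at (ussr_advice L p n)"

abbreviation scan_config ::
  "ussr_state \<Rightarrow> bool list \<Rightarrow> bool list \<Rightarrow> int \<Rightarrow> tape \<Rightarrow> int \<Rightarrow> nat \<Rightarrow> tm_config" where
  "scan_config q pre xs h A j c \<equiv>
     config q (tape_split pre xs) (advice_tape h) A (counter_tape j) (counter_tape (int c - 1))"

abbreviation word_position :: "nat \<Rightarrow> int" where
  "word_position j \<equiv> int (length (ussr_advice L p j))"

abbreviation scan_time :: "bool list \<Rightarrow> nat" where
  "scan_time xs \<equiv> scan_step_time L n * length xs + 2"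

text \<open>
  \<open>V\<close> is the sum accumulated on the prefix \<open>pre\<close>.  At the start of a block the heads on the advice
  and on the first counter are wherever the previous block has left them.
\<close>

fun scan_configs ::
  "(bool \<times> nat) option \<Rightarrow> nat \<Rightarrow> int \<Rightarrow> bool list \<Rightarrow> bool list \<Rightarrow> tm_config set" where
  "scan_configs None c V pre xs =
     {scan_config Block pre xs (int i) (tape_end as) (int j) c | i j as.
      i \<le> length (ussr_advice L p n) \<and> j \<le> k \<and> c \<le> k \<and> holds_negative L as V}"
| "scan_configs (Some (s, j)) c V pre xs =
     {scan_config (Unary s (0 < j)) pre xs (word_position j) (tape_end as) (int j) c | as.
      j \<le> k \<and> c \<le> k \<and> holds_negative L as V}"

lemma decides_scan_end:
  assumes "cf \<in> scan_configs None 0 V pre []"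
  shows "decides ussr_tm 2 cf (bit (- V) (L - 1))"
proof -
  obtain i j as where as: "holds_negative L as V" and
    cf: "cf = scan_config Block pre [] (int i) (tape_end as) (int j) 0"
    using assms by auto
  let ?final = "scan_config Final pre [] (int i) (tape_at as (int (length as) - 1)) (int j) 0"
  have "tm_step ussr_tm cf = ?final"
    by (simp add: cf tm_step_move read_tape_at[of _ "- 1"])
  moreover have "decides ussr_tm 1 ?final (bit (- V) (L - 1))"
    by (rule decides_step) (simp add: tm_step_move read_top_bit[OF as L])
  ultimately show ?thesis
    using reaches_decides[OF reaches_step] by (metis one_add_one)
qed

lemma decides_scan_premature_end:
  assumes "cf \<in> scan_configs None (Suc c) V pre []"
  shows "decides ussr_tm 1 cf False"
  using assms by (intro decides_step) (auto simp: tm_step_move read_tape_at)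

lemma decides_scan_surplus:
  assumes "cf \<in> scan_configs None 0 V pre (s # xs)"
  shows "decides ussr_tm 1 cf False"
  using assms by (intro decides_step) (auto simp: tm_step_move read_tape_at[of _ "- 1"])

lemma decides_scan_unterminated:
  assumes "cf \<in> scan_configs (Some (s, j)) c V pre []"
  shows "decides ussr_tm 1 cf False"
  using assms by (intro decides_step) (auto simp: tm_step_move)

lemma decides_scan_too_long:
  assumes "cf \<in> scan_configs (Some (s, j)) c V pre (True # xs)" and "\<not> j < k"
  shows "decides ussr_tm 1 cf False"
  using assms by (intro decides_step) (auto simp: tm_step_move read_tape_at[of "replicate k False"])

lemma decides_scan_empty_block:
  assumes "cf \<in> scan_configs (Some (s, 0)) c V pre (False # xs)"
  shows "decides ussr_tm 1 cf False"
  using assms by (intro decides_step) (auto simp: tm_step_move)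

lemma decides_scan_block_end:
  assumes "cf \<in> scan_configs (Some (s, j)) c V pre (False # xs)" and "0 < j"
    and rest: "\<And>cf'. cf' \<in> scan_configs None c V (pre @ [False]) xs \<Longrightarrow>
      decides ussr_tm (scan_time xs) cf' b"
  shows "decides ussr_tm (scan_time (False # xs)) cf b"
proof -
  obtain as where as: "j \<le> k" "c \<le> k" "holds_negative L as V" and
    cf: "cf = scan_config (Unary s (0 < j)) pre (False # xs)
           (word_position j) (tape_end as) (int j) c"
    using assms(1) by auto
  let ?block = "scan_config Block (pre @ [False]) xs (word_position j) (tape_end as) (int j) c"
  have "tm_step ussr_tm cf = ?block"
    using assms(2) by (simp add: cf tm_step_move add.commute)
  then have "reaches ussr_tm (scan_step_time L n) cf ?block"
    by (rule reaches_mono[OF reaches_step]) (simp add: scan_step_time_def)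
  moreover have "length (ussr_advice L p j) \<le> length (ussr_advice L p n)"
    unfolding length_ussr_advice using as(1) k by (intro mult_le_mono1) simp
  then have "?block \<in> scan_configs None c V (pre @ [False]) xs"
    using as unfolding scan_configs.simps by blast
  ultimately have "decides ussr_tm (scan_step_time L n + scan_time xs) cf b"
    by (intro reaches_decides rest)
  then show ?thesis by simp
qed

lemma decides_scan_block_start:
  assumes "cf \<in> scan_configs None (Suc c) V pre (s # xs)"
    and rest: "\<And>cf'. cf' \<in> scan_configs (Some (s, 0)) c V (pre @ [s]) xs \<Longrightarrow>
      decides ussr_tm (scan_time xs) cf' b"
  shows "decides ussr_tm (scan_time (s # xs)) cf b"
proof -
  obtain i j as where ij: "i \<le> length (ussr_advice L p n)" "j \<le> k" "Suc c \<le> k"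
    and as: "holds_negative L as V" and
    cf: "cf = scan_config Block pre (s # xs) (int i) (tape_end as) (int j) (Suc c)"
    using assms(1) by auto
  let ?conf = "\<lambda>q h j. scan_config q (pre @ [s]) xs h (tape_end as) j c"
  have "tm_step ussr_tm cf = ?conf (Rewind s) (int i - 1) (int j - 1)"
    using ij(3) by (simp add: cf tm_step_move read_tape_at[of "replicate k False"] add.commute)
  moreover have "reaches ussr_tm (n * (2 * L + 1) + n + 1)
      (?conf (Rewind s) (int i - 1) (int j - 1)) (?conf (Unary s False) 0 0)"
    using ij k by (intro reaches_Rewind) simp_all
  ultimately have "reaches ussr_tm (1 + (n * (2 * L + 1) + n + 1)) cf (?conf (Unary s False) 0 0)"
    by (rule reaches_trans[OF reaches_step])
  then have "reaches ussr_tm (scan_step_time L n) cf (?conf (Unary s False) 0 0)"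
    by (rule reaches_mono) (simp add: scan_step_time_def)
  moreover have "?conf (Unary s False) 0 0 \<in> scan_configs (Some (s, 0)) c V (pre @ [s]) xs"
    using as ij(3) by auto
  ultimately have "decides ussr_tm (scan_step_time L n + scan_time xs) cf b"
    by (intro reaches_decides rest)
  then show ?thesis by simp
qed

lemma decides_scan_increment:
  assumes "cf \<in> scan_configs (Some (s, j)) c V pre (True # xs)" and "j < k"
    and rest: "\<And>cf'. cf' \<in> scan_configs (Some (s, Suc j)) c
      (V + (if s then p j else - p j)) (pre @ [True]) xs \<Longrightarrow> decides ussr_tm (scan_time xs) cf' b"
  shows "decides ussr_tm (scan_time (True # xs)) cf b"
proof -
  obtain as where c: "c \<le> k" and as: "holds_negative L as V" and
    cf: "cf = scan_config (Unary s (0 < j)) pre (True # xs)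
           (word_position j) (tape_end as) (int j) c"
    using assms(1) by auto
  have len: "length as = L \<or> as = []" using as by (auto simp: holds_negative_def)
  define w where "w = twos_complement L (p j)"
  define as' where "as' = add_bits s False as w"
  obtain ys where ys: "ussr_advice L p n = ussr_advice L p j @ advice_block w @ ys"
    using ussr_advice_split[of j n L p] assms(2) k unfolding w_def by auto
  let ?conf = "\<lambda>q i A. scan_config q (pre @ [True]) xs (word_position i) A (int (Suc j)) c"
  let ?next = "?conf (Unary s True) (Suc j) (tape_end as')"
  have "tm_step ussr_tm cf = ?conf (AccRewind s) j (tape_at as (int (length as) - 1))"
    using assms(2) by (simp add: cf tm_step_move read_tape_at[of "replicate k False"] add.commute)
  moreover have "reaches ussr_tm (length as + 1)
      (?conf (AccRewind s) j (tape_at as (int (length as) - 1)))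
      (?conf (Digit s False) j (tape_at as 0))"
    by (rule reaches_AccRewind) simp
  moreover have "reaches ussr_tm (2 * L + 1) (?conf (Digit s False) j (tape_at as 0)) ?next"
    using reaches_add_bits[of as w s False _ "ussr_advice L p j" ys "[]"] len
    by (simp add: ys as'_def ussr_advice_Suc w_def)
  ultimately have "reaches ussr_tm (1 + ((length as + 1) + (2 * L + 1))) cf ?next"
    by (intro reaches_trans[OF reaches_step reaches_trans])
  then have "reaches ussr_tm (scan_step_time L n) cf ?next"
    using len by (elim reaches_mono) (auto simp: scan_step_time_def)
  moreover have
    "?next \<in> scan_configs (Some (s, Suc j)) c (V + (if s then p j else - p j)) (pre @ [True]) xs"
    using holds_negative_add_bits[OF as, of s "p j"] assms(2) c
    unfolding scan_configs.simps as'_def w_def by (intro CollectI exI conjI refl) auto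
  ultimately have "decides ussr_tm (scan_step_time L n + scan_time xs) cf b"
    by (intro reaches_decides rest)
  then show ?thesis by simp
qed

lemma decides_scan:
  assumes "cf \<in> scan_configs pos c V pre xs"
  shows "decides ussr_tm (scan_time xs) cf (scan_accepts L p k pos c V xs)"
  using assms
proof (induction pos c xs arbitrary: cf V pre rule: ussr_scan.induct[of _ k])
  case 1
  from decides_scan_end[OF this] show ?case by (simp add: scan_accepts_simps numeral_2_eq_2)
next
  case (2 c)
  from decides_scan_premature_end[OF this] show ?case by (simp add: scan_accepts_simps decides_mono)
next
  case (3 s xs)
  from decides_scan_surplus[OF this] show ?case by (simp add: scan_accepts_simps decides_mono)
next
  case (4 c s xs)
  show ?case
    unfolding scan_accepts_simps by (rule decides_scan_block_start[OF "4.prems"]) (rule "4.IH")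
next
  case (5 s j c)
  from decides_scan_unterminated[OF this] show ?case by (simp add: scan_accepts_simps decides_mono)
next
  case (6 s j c xs)
  show ?case
  proof (cases "j < k")
    case True
    from decides_scan_increment[OF "6.prems" True "6.IH"[OF True]] show ?thesis
      unfolding scan_accepts_simps eqTrueI[OF True] simp_thms .
  next
    case False
    from decides_scan_too_long[OF "6.prems" False] False show ?thesis
      by (simp add: scan_accepts_simps decides_mono)
  qed
next
  case (7 s j c xs)
  show ?case
  proof (cases "0 < j")
    case True
    from decides_scan_block_end[OF "7.prems" True "7.IH"[OF True]] show ?thesis
      unfolding scan_accepts_simps eqTrueI[OF True] simp_thms .
  next
    case False
    with "7.prems" have "decides ussr_tm 1 cf False" by (intro decides_scan_empty_block) simp
    with False show ?thesis by (simp add: scan_accepts_simps decides_mono)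
  qed
qed

end

lemma reaches_Prefix:
  "reaches ussr_tm m
     (config Prefix (tape_split (replicate i True) (replicate m True @ xs)) Y A
        (tape_end (replicate i False)) (tape_end (replicate i False)))
     (config Prefix (tape_split (replicate (i + m) True) xs) Y A
        (tape_end (replicate (i + m) False)) (tape_end (replicate (i + m) False)))"
proof (induction m arbitrary: i)
  case 0
  show ?case by simp
next
  case (Suc m)
  let ?X = "tape_split (replicate i True) (True # replicate m True @ xs)"
  let ?K = "tape_end (replicate i False)" and ?K' = "tape_end (replicate (Suc i) False)"
  have "read_tape ?X = 2"
    using read_tape_split[of "replicate i True" True] by (simp only: bit_symbol_simps)
  moreover have "act_tape (1, MoveRight) ?K = ?K'"
    using act_tape_split[of False MoveRight "replicate i False" "[]"]
    by (simp add: bit_symbol_def replicate_append_same add.commute)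
  ultimately have "tm_step ussr_tm (config Prefix ?X Y A ?K ?K) =
      config Prefix (tape_split (replicate (Suc i) True) (replicate m True @ xs)) Y A ?K' ?K'"
    by (simp add: tm_step_config Let_def act_tape_read replicate_app_Cons_same add.commute)
  from reaches_trans[OF reaches_step[OF this] Suc.IH] show ?case by simp
qed

lemma reaches_unary_prefix:
  "reaches ussr_tm m (tm_init ussr_tm (replicate m True @ xs) y)
     (config Prefix (tape_split (replicate m True) xs) (tape_at y 0) (tape_at [] 0)
        (tape_end (replicate m False)) (tape_end (replicate m False)))"
proof -
  have "tm_init ussr_tm x y =
      config Prefix (tape_at x 0) (tape_at y 0) (tape_at [] 0) (tape_at [] 0) (tape_at [] 0)" for x
    by (simp add: tm_init_def bits_tape_eq_tape_at blank_tape_eq_tape_at numeral_eq_Suc)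
  then show ?thesis using reaches_Prefix[of m 0 xs] by simp
qed

lemma decides_all_True: "decides ussr_tm (m + 1) (tm_init ussr_tm (replicate m True) y) False"
proof (rule reaches_decides)
  show "reaches ussr_tm m (tm_init ussr_tm (replicate m True) y)
      (config Prefix (tape_end (replicate m True)) (tape_at y 0) (tape_at [] 0)
        (tape_end (replicate m False)) (tape_end (replicate m False)))"
    using reaches_unary_prefix[of m "[]"] by simp
qed (intro decides_step, simp add: tm_step_move read_tape_at)

lemma reaches_first_block:
  "reaches ussr_tm (m + 1) (tm_init ussr_tm (replicate m True @ False # xs) y)
     (config Block (tape_split (replicate m True @ [False]) xs) (tape_at y 0) (tape_at [] 0)
        (tape_end (replicate m False)) (tape_at (replicate m False) (int m - 1)))"
proof (rule reaches_trans[OF reaches_unary_prefix reaches_step])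
  have "read_tape (tape_split (replicate m True) (False # xs)) = 1"
    using read_tape_split[of "replicate m True" False] by (simp only: bit_symbol_simps) simp
  then show "tm_step ussr_tm
      (config Prefix (tape_split (replicate m True) (False # xs)) (tape_at y 0) (tape_at [] 0)
        (tape_end (replicate m False)) (tape_end (replicate m False))) =
      config Block (tape_split (replicate m True @ [False]) xs) (tape_at y 0) (tape_at [] 0)
        (tape_end (replicate m False)) (tape_at (replicate m False) (int m - 1))"
    by (simp add: tm_step_move add.commute)
qed

lemma all_True_or_unary_prefix:
  obtains (all_True) m where "xs = replicate m True"
    | (unary_prefix) m ys where "xs = replicate m True @ False # ys"
proof (cases "False \<in> set xs")
  case False
  then have "replicate (length xs) True = xs" by (intro replicate_length_same) metis
  then show thesis by (rule that(1)[OF sym])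
next
  case True
  then obtain us ys where "xs = us @ False # ys" "False \<notin> set us"
    using split_list_first by metis
  moreover from this have "replicate (length us) True = us" by (intro replicate_length_same) metis
  ultimately show thesis using that(2) by metis
qed

lemma decides_ussr_accepts:
  assumes "L > 0"
  shows "decides ussr_tm (scan_step_time L (length x) * length x + 2)
    (tm_init ussr_tm x (ussr_advice L p (length x))) (ussr_accepts L p x)"
proof -
  let ?n = "length x" and ?T = "scan_step_time L (length x)"
  have T: "j \<le> ?T * j" for j by (simp add: scan_step_time_def)
  show ?thesis
  proof (cases x rule: all_True_or_unary_prefix)
    case (all_True m)
    then have "\<not> ussr_accepts L p x"
      unfolding ussr_accepts_def by (metis in_set_conv_decomp in_set_replicate)
    moreover have "?n = m" using all_True by simp
    then have "m + 1 \<le> ?T * ?n + 2" using T[of ?n] by linarith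
    ultimately show ?thesis using decides_mono[OF decides_all_True] all_True by auto
  next
    case (unary_prefix m xs)
    let ?block = "config Block (tape_split (replicate m True @ [False]) xs)
        (tape_at (ussr_advice L p ?n) 0) (tape_at [] 0)
        (tape_end (replicate m False)) (tape_at (replicate m False) (int m - 1))"
    have m: "m \<le> ?n" using unary_prefix by simp
    have "?block \<in> scan_configs L ?n m p None m 0 (replicate m True @ [False]) xs"
      unfolding scan_configs.simps[OF assms m] mem_Collect_eq
      by (intro exI[of _ 0] exI[of _ m] exI[of _ "[]"]) (simp add: holds_negative_def)
    note reaches_decides[OF reaches_first_block decides_scan[OF assms m this], folded unary_prefix]
    moreover have "ussr_accepts L p x \<longleftrightarrow> scan_accepts L p m None m 0 xs"
      using unary_prefix by (auto simp: ussr_accepts_def unary_block_inject)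
    moreover have "m + 1 + (?T * length xs + 2) \<le> ?T * ?n + 2"
      using T[of "m + 1"] unary_prefix by (simp add: algebra_simps)
    ultimately show ?thesis by (simp only: decides_mono)
  qed
qed

section \<open>Scans of encoded instances\<close>

fun unary_block :: "bool \<times> nat \<Rightarrow> bool list" where
  "unary_block (s, a) = s # replicate a True @ [False]"

fun block_increments :: "bool \<times> nat \<Rightarrow> (bool \<times> nat) list" where
  "block_increments (s, a) = map (Pair s) [0..<a]"

lemma ussr_scan_block_rest:
  assumes "j \<le> k"
  shows "ussr_scan k (Some (s, j)) c (replicate m True @ False # xs) =
    (if 0 < j + m \<and> j + m \<le> k
     then map_option ((@) (map (Pair s) [j..<j + m])) (ussr_scan k None c xs) else None)"
  using assms
proof (induction m arbitrary: j)
  case 0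
  then show ?case by (simp add: option.map_ident)
next
  case (Suc m)
  show ?case
  proof (cases "j < k")
    case True
    have "[j..<j + Suc m] = j # [Suc j..<Suc j + m]" by (simp add: upt_conv_Cons)
    with True Suc.IH[of "Suc j"] show ?thesis
      by (simp add: option.map_comp o_def del: upt_Suc)
  qed simp
qed

lemma ussr_scan_unary_block:
  "ussr_scan k None (Suc c) (unary_block (s, a) @ xs) =
     (if 1 \<le> a \<and> a \<le> k
      then map_option ((@) (block_increments (s, a))) (ussr_scan k None c xs) else None)"
  using ussr_scan_block_rest[of 0 k s c a xs] by (simp add: Suc_le_eq)

lemma ussr_scan_all_True: "ussr_scan k (Some (s, j)) c (replicate m True) = None"
  by (induction m arbitrary: j) simp_all

lemma ussr_scan_Suc_eq_SomeE:
  assumes "ussr_scan k None (Suc c) xs = Some ts"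
  obtains s a ys us where "xs = unary_block (s, a) @ ys" and "1 \<le> a" and "a \<le> k"
    and "ussr_scan k None c ys = Some us" and "ts = block_increments (s, a) @ us"
proof -
  obtain s zs where xs: "xs = s # zs" using assms by (cases xs) auto
  show thesis
  proof (cases zs rule: all_True_or_unary_prefix)
    case (all_True m)
    then show ?thesis using assms by (simp add: xs ussr_scan_all_True)
  next
    case (unary_prefix a ys)
    then have "xs = unary_block (s, a) @ ys" using xs by simp
    with assms that show ?thesis
      by (auto simp: ussr_scan_unary_block split: if_splits
          simp del: unary_block.simps block_increments.simps)
  qed
qed

lemma ussr_scan_eq_Some_iff:
  "ussr_scan k None c xs = Some ts \<longleftrightarrow>
     (\<exists>ds. length ds = c \<and> (\<forall>(s, a)\<in>set ds. 1 \<le> a \<and> a \<le> k) \<and>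
       xs = concat (map unary_block ds) \<and> ts = concat (map block_increments ds))"
  (is "_ \<longleftrightarrow> (\<exists>ds. ?blocks c xs ts ds)")
proof
  show "\<exists>ds. ?blocks c xs ts ds" if "ussr_scan k None c xs = Some ts"
    using that
  proof (induction c arbitrary: xs ts)
    case 0
    then show ?case by (cases xs) auto
  next
    case (Suc c)
    from Suc.prems obtain s a ys us where block: "xs = unary_block (s, a) @ ys" "1 \<le> a" "a \<le> k"
      "ts = block_increments (s, a) @ us" and "ussr_scan k None c ys = Some us"
      by (rule ussr_scan_Suc_eq_SomeE)
    from Suc.IH[OF this(5)] obtain ds where "?blocks c ys us ds" ..
    with block have "?blocks (Suc c) xs ts ((s, a) # ds)" by simp
    then show ?case ..
  qed
next
  assume "\<exists>ds. ?blocks c xs ts ds"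
  then obtain ds where "?blocks c xs ts ds" ..
  then show "ussr_scan k None c xs = Some ts"
  proof (induction ds arbitrary: c xs ts)
    case Nil
    then show ?case by simp
  next
    case (Cons d ds)
    obtain s a where "d = (s, a)" by fastforce
    with Cons show ?case
      by (auto simp: ussr_scan_unary_block simp del: unary_block.simps block_increments.simps)
  qed
qed

lemma ussr_scan_bounds:
  assumes "ussr_scan k pos c xs = Some ts"
  shows "length ts \<le> length xs \<and> snd ` set ts \<subseteq> {..<k}"
  using assms
  by (induction pos c xs arbitrary: ts rule: ussr_scan.induct[of _ k])
    (fastforce split: if_splits)+

definition signed_entries :: "nat \<Rightarrow> (nat \<Rightarrow> nat) \<Rightarrow> (nat \<Rightarrow> int) \<Rightarrow> (bool \<times> nat) list" where
  "signed_entries k a \<delta> = map (\<lambda>i. (\<delta> i = 1, a i)) [1..<Suc k]"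

lemma ussr_encode_eq_blocks:
  "ussr_encode k a \<delta> = replicate k True @ False # concat (map unary_block (signed_entries k a \<delta>))"
  by (simp add: ussr_encode_def signed_entries_def o_def del: upt_Suc)

lemma ex_signed_entries:
  assumes "length ds = k" and "k \<ge> 1" and ds: "\<forall>(s, a)\<in>set ds. 1 \<le> a \<and> a \<le> k"
  obtains a \<delta> where "ussr_instance k a \<delta>" and "ds = signed_entries k a \<delta>"
proof
  let ?a = "\<lambda>i. snd (ds ! (i - 1))" and ?\<delta> = "\<lambda>i. if fst (ds ! (i - 1)) then 1 else - 1 :: int"
  have "1 \<le> ?a i \<and> ?a i \<le> k" if "i \<in> {1..k}" for i
  proof -
    have "ds ! (i - 1) \<in> set ds" using that assms(1) by (intro nth_mem) auto
    with ds show ?thesis by (auto simp: case_prod_beta)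
  qed
  then show "ussr_instance k ?a ?\<delta>" using assms(2) by (simp add: ussr_instance_def)
  show "ds = signed_entries k ?a ?\<delta>"
    unfolding signed_entries_def
    by (rule nth_equalityI) (auto simp: assms(1) prod_eq_iff simp del: upt_Suc)
qed

definition sqrt_increment :: "nat \<Rightarrow> real" where
  "sqrt_increment j = sqrt (real (Suc j)) - sqrt (real j)"

lemma signed_sum_block_increments:
  "signed_sum sqrt_increment (block_increments (s, a)) =
     (if s then sqrt (real a) else - sqrt (real a))"
  by (induction a) (auto simp: sqrt_increment_def)

lemma signed_sum_concat: "signed_sum f (concat tss) = (\<Sum>ts\<leftarrow>tss. signed_sum f ts)"
  by (induction tss) simp_all

lemma signed_sum_signed_entries:
  assumes "ussr_instance k a \<delta>"
  shows "signed_sum sqrt_increment (concat (map block_increments (signed_entries k a \<delta>))) =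
    (\<Sum>i = 1..k. real_of_int (\<delta> i) * sqrt (real (a i)))"
proof -
  have "signed_sum sqrt_increment (concat (map block_increments (signed_entries k a \<delta>))) =
      (\<Sum>i\<leftarrow>[1..<Suc k]. signed_sum sqrt_increment (block_increments (\<delta> i = 1, a i)))"
    by (simp add: signed_sum_concat signed_entries_def o_def del: upt_Suc block_increments.simps)
  also have "\<dots> = (\<Sum>i = 1..k. signed_sum sqrt_increment (block_increments (\<delta> i = 1, a i)))"
    by (simp add: interv_sum_list_conv_sum_set_nat atLeastLessThanSuc_atLeastAtMost
        del: upt_Suc block_increments.simps)
  also have "\<dots> = (\<Sum>i = 1..k. real_of_int (\<delta> i) * sqrt (real (a i)))"
  proof (intro sum.cong refl)
    fix i assume "i \<in> {1..k}"
    with assms have "\<delta> i = - 1 \<or> \<delta> i = 1" by (auto simp: ussr_instance_def)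
    then show "signed_sum sqrt_increment (block_increments (\<delta> i = 1, a i)) =
        real_of_int (\<delta> i) * sqrt (real (a i))"
      unfolding signed_sum_block_increments by auto
  qed
  finally show ?thesis .
qed

lemma USSR_iff_scan:
  "x \<in> USSR \<longleftrightarrow> (\<exists>k xs. x = replicate k True @ False # xs \<and>
     (\<exists>ts\<in>set_option (ussr_scan k None k xs). signed_sum sqrt_increment ts > 0))"
  (is "_ \<longleftrightarrow> ?scan")
proof
  assume "x \<in> USSR"
  then obtain k a \<delta> where x: "x = ussr_encode k a \<delta>" and inst: "ussr_instance k a \<delta>"
    and pos: "(\<Sum>i = 1..k. real_of_int (\<delta> i) * sqrt (real (a i))) > 0"
    unfolding USSR_def by blast
  let ?ds = "signed_entries k a \<delta>"
  have "length ?ds = k" "\<forall>(s, b)\<in>set ?ds. 1 \<le> b \<and> b \<le> k"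
    using inst by (auto simp: signed_entries_def ussr_instance_def simp del: upt_Suc)
  then have "ussr_scan k None k (concat (map unary_block ?ds)) =
      Some (concat (map block_increments ?ds))"
    unfolding ussr_scan_eq_Some_iff by blast
  with x pos show ?scan
    unfolding ussr_encode_eq_blocks signed_sum_signed_entries[OF inst, symmetric] by auto
next
  assume ?scan
  then obtain k xs ts where x: "x = replicate k True @ False # xs"
    and "ussr_scan k None k xs = Some ts" and pos: "signed_sum sqrt_increment ts > 0"
    by auto
  then obtain ds where ds: "length ds = k" "\<forall>(s, a)\<in>set ds. 1 \<le> a \<and> a \<le> k"
    and xs: "xs = concat (map unary_block ds)" and ts: "ts = concat (map block_increments ds)"
    unfolding ussr_scan_eq_Some_iff by blast
  have "k \<ge> 1" using pos ds(1) ts by (cases ds) auto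
  from ex_signed_entries[OF ds(1) this ds(2)] obtain a \<delta>
    where inst: "ussr_instance k a \<delta>" and "ds = signed_entries k a \<delta>" .
  then have "x = ussr_encode k a \<delta>" "(\<Sum>i = 1..k. real_of_int (\<delta> i) * sqrt (real (a i))) > 0"
    using pos by (simp_all add: x xs ts ussr_encode_eq_blocks signed_sum_signed_entries)
  with inst show "x \<in> USSR" unfolding USSR_def by blast
qed

lemma ex_ussr_weights:
  "\<exists>p. \<forall>x. length x = n \<longrightarrow> (x \<in> USSR \<longleftrightarrow> ussr_accepts (sign_weight_width n) p x)"
proof -
  obtain p :: "nat \<Rightarrow> int" where p: "\<And>ts. length ts \<le> n \<Longrightarrow> snd ` set ts \<subseteq> {..<n} \<Longrightarrow>
      bit (- signed_sum p ts) (sign_weight_width n - 1) \<longleftrightarrow> signed_sum sqrt_increment ts > 0"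
    using ex_sign_weights[of n sqrt_increment] by blast
  have "bit (- signed_sum p ts) (sign_weight_width n - 1) \<longleftrightarrow> signed_sum sqrt_increment ts > 0"
    if "length (replicate k True @ False # xs) = n" "ts \<in> set_option (ussr_scan k None k xs)"
    for k xs ts
  proof -
    have "length ts \<le> length xs" "snd ` set ts \<subseteq> {..<k}"
      using ussr_scan_bounds[of k None k xs ts] that(2) by simp_all
    with that(1) show ?thesis by (intro p) auto
  qed
  then show ?thesis
    unfolding USSR_iff_scan ussr_accepts_def scan_accepts_def add_0 by blast
qed

theorem theorem1: "USSR \<in> P_poly"
proof -
  let ?L = sign_weight_width and ?var = "[:0, 1:] :: nat poly"
  obtain p :: "nat \<Rightarrow> nat \<Rightarrow> int" where
    p: "\<And>x. x \<in> USSR \<longleftrightarrow> ussr_accepts (?L (length x)) (p (length x)) x"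
    using ex_ussr_weights by metis
  define adv where "adv n = ussr_advice (?L n) (p n) n" for n
  define width :: "nat poly" where "width = (?var + 1) * ((?var + 1) * ?var) + ?var + 1"
  define len :: "nat poly" where "len = ?var * (2 * width + 1)"
  define time :: "nat poly" where "time = (len + ?var + 3 * width + 3) * ?var + 2"
  have width: "poly width n = ?L n" for n
    by (simp add: width_def sign_weight_width_def algebra_simps)
  have "length (adv n) \<le> poly len n" for n
    by (simp add: adv_def len_def width)
  moreover have time: "poly time n = scan_step_time (?L n) n * n + 2" for n
    by (simp add: time_def len_def width scan_step_time_def algebra_simps)
  have "decides ussr_tm (poly time (length x)) (tm_init ussr_tm x (adv (length x))) (x \<in> USSR)"
    for x
    unfolding time adv_def p by (intro decides_ussr_accepts) (simp add: sign_weight_width_def)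
  ultimately show ?thesis
    unfolding P_poly_def decides_tm_init_iff using wf_ussr_tm by blast
qed

end
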